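(* Let $\mathbf{d}=(d_1,\ldots,d_n)$ be a graphic sequence with $d_1\ge d_2\ge\cdots\ge d_n$, and let $\delta\le n$ be a positive even integer. Then $\mathbf{d}\circ\delta=(d_1,\ldots,d_n,\delta)$ is graphic if and only if there is a realization $G$ of $\mathbf{d}$ on vertices $v_1,\ldots,v_n$ with $\deg_G(v_i)=d_i$ which has a matching of size $\delta/2$ covering the vertices $v_1,\ldots,v_\delta$ (the vertices with the $\delta$ largest degrees).
   Context: A finite sequence of nonnegative integers is graphic if there is a simple graph with a vertex labelling whose degree sequence is that sequence; such a graph is a realization. $\mathbf{d}\circ\delta$ denotes $\mathbf{d}$ with $\delta$ appended. A matching is a set of pairwise disjoint edges; it covers a vertex if some edge of it is incident to that vertex. *)

theory Defs
  imports Complex_Main "HOL-Library.Ramsey" "HOL-Library.Disjoint_Sets"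
begin

definition simple_graph :: "'a set \<Rightarrow> 'a set set \<Rightarrow> bool" where
  "simple_graph V E \<longleftrightarrow> finite V \<and> E \<subseteq> nsets V 2"

definition degree :: "'a set set \<Rightarrow> 'a \<Rightarrow> nat" where
  "degree E v = card {e \<in> E. v \<in> e}"

(* A vertex labelling is a distinct list of all vertices; since lists are indexed
   from 0, the vertex v_i of the usual notation is vs ! (i - 1). *)
definition realization :: "'a list \<Rightarrow> 'a set set \<Rightarrow> nat list \<Rightarrow> bool" where
  "realization vs E d \<longleftrightarrow>
     distinct vs \<and> simple_graph (set vs) E \<and> map (degree E) vs = d"

(* HOL cannot quantify over the type of vertices.  Taking vertices in nat loses
   nothing: see realization_imp_graphic. *)
definition graphic :: "nat list \<Rightarrow> bool" where
  "graphic d \<longleftrightarrow> (\<exists>(vs :: nat list) E. realization vs E d)"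

definition matching :: "'a set set \<Rightarrow> 'a set set \<Rightarrow> bool" where
  "matching E M \<longleftrightarrow> M \<subseteq> E \<and> disjoint M"

definition covers :: "'a set set \<Rightarrow> 'a \<Rightarrow> bool" where
  "covers M v \<longleftrightarrow> (\<exists>e\<in>M. v \<in> e)"

lemma realization_image:
  assumes R: "realization vs E d" and f: "inj_on f (set vs)"
  shows "realization (map f vs) ((`) f ` E) d"
proof -
  have E: "E \<subseteq> nsets (set vs) 2" and dist: "distinct vs" and d: "map (degree E) vs = d"
    using R by (auto simp: realization_def simple_graph_def)
  have sub: "e \<subseteq> set vs" if "e \<in> E" for e
    using E that by (auto simp: nsets_def)
  have inj: "inj_on ((`) f) E"
    using f sub by (intro inj_on_subset[OF inj_on_image_Pow[OF f]]) auto
  have deg: "degree ((`) f ` E) (f v) = degree E v" if "v \<in> set vs" for v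
  proof -
    have "f v \<in> f ` e \<longleftrightarrow> v \<in> e" if "e \<in> E" for e
      using inj_on_image_mem_iff[OF f \<open>v \<in> set vs\<close> sub[OF that]] .
    then have "{e' \<in> (`) f ` E. f v \<in> e'} = (`) f ` {e \<in> E. v \<in> e}"
      by auto
    then show ?thesis
      unfolding degree_def using card_image[OF inj_on_subset[OF inj, of "{e \<in> E. v \<in> e}"]]
      by auto
  qed
  have "(`) f ` E \<subseteq> nsets (f ` set vs) 2"
  proof
    fix e' assume "e' \<in> (`) f ` E"
    then obtain e where e: "e \<in> E" "e' = f ` e" by auto
    have "card e' = card e"
      using e card_image[OF inj_on_subset[OF f sub]] by auto
    then show "e' \<in> nsets (f ` set vs) 2"
      using E e sub[OF e(1)] by (auto simp: nsets_def)
  qed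
  then show ?thesis
    unfolding realization_def simple_graph_def d[symmetric]
    using dist deg f by (simp add: distinct_map)
qed

lemma realization_imp_graphic:
  fixes vs :: "'a list"
  assumes "realization vs E d"
  shows "graphic d"
proof -
  obtain f :: "'a \<Rightarrow> nat" where "inj_on f (set vs)"
    by (meson List.finite_set finite_imp_inj_to_nat_seg)
  then show ?thesis
    unfolding graphic_def by (intro exI) (rule realization_image[OF assms])
qed

end

theory Submission
  imports Defs
begin

text \<open>
  If \<open>d \<circ> \<delta>\<close> is graphic, edge switches in the manner of Havel and Hakimi make the new vertex
  adjacent to exactly \<open>v\<^sub>1, \<dots>, v\<^sub>\<delta>\<close>; deleting it gives a graph \<open>H\<close> whose degrees are those of \<open>d\<close>,
  lowered by one at these vertices. Let \<open>G\<close> realize \<open>d\<close> on the same vertices, and call the edges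
  of \<open>G - H\<close> red and those of \<open>H - G\<close> blue. If \<open>G\<close> and \<open>H\<close> are chosen with the fewest blue edges,
  then the ends of every red-blue-red path are joined by a red edge, as otherwise a switch in \<open>G\<close>
  or in \<open>H\<close> would remove a blue edge. Suppose there is a blue edge, let \<open>c\<close> have the largest red
  degree among the vertices on blue edges, let \<open>bc\<close> be blue and \<open>ab\<close> red. Then \<open>a\<close> is red-adjacent to
  \<open>b\<close>, to all red neighbours of \<open>c\<close> other than \<open>a\<close>, and to \<open>c\<close> in case \<open>a\<close> is one of these
  neighbours; so \<open>a\<close> has larger red degree than \<open>c\<close> and therefore lies on a blue edge, a
  contradiction. Hence \<open>H \<subseteq> G\<close>, and \<open>G - H\<close> is the matching. Conversely, one exchanges the
  matching for the edges from a new vertex to \<open>v\<^sub>1, \<dots>, v\<^sub>\<delta>\<close>.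
\<close>

section \<open>Neighbourhoods and degrees in simple graphs\<close>

definition neighbours :: "'a set set \<Rightarrow> 'a \<Rightarrow> 'a set" where
  "neighbours E v = {u. {v, u} \<in> E}"

text \<open>The arguments go round a 4-cycle whose sides are alternately removed and added; rotating
  them by one place swaps the two roles.\<close>

definition switch :: "'a set set \<Rightarrow> 'a \<Rightarrow> 'a \<Rightarrow> 'a \<Rightarrow> 'a \<Rightarrow> 'a set set" where
  "switch E a b c d = (E - {{a, b}, {c, d}}) \<union> {{b, c}, {a, d}}"

lemma simple_graph_finite:
  assumes "simple_graph V E"
  shows "finite V" "finite E"
  using assms finite_imp_finite_nsets finite_subset
  unfolding simple_graph_def by blast+

lemma simple_graph_subset: "simple_graph V E \<Longrightarrow> F \<subseteq> E \<Longrightarrow> simple_graph V F"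
  by (auto simp: simple_graph_def)

lemma doubleton_in_nsets: "{a, b} \<in> nsets V 2 \<longleftrightarrow> a \<noteq> b \<and> a \<in> V \<and> b \<in> V"
  by (auto simp: nsets_def card_insert_if)

lemma simple_graph_edge:
  assumes "simple_graph V E" "{a, b} \<in> E"
  shows "a \<noteq> b" "a \<in> V" "b \<in> V"
proof -
  have "{a, b} \<in> nsets V 2"
    using assms unfolding simple_graph_def by blast
  then show "a \<noteq> b" "a \<in> V" "b \<in> V"
    by (simp_all add: doubleton_in_nsets)
qed

lemma simple_graph_edge_at:
  assumes "simple_graph V E" "e \<in> E" "v \<in> e"
  obtains u where "e = {v, u}" "u \<noteq> v"
proof -
  have "card e = 2"
    using assms by (auto simp: simple_graph_def nsets_def)
  then show ?thesis
    using assms(3) that by (auto simp: card_2_iff)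
qed

lemma degree_doubleton:
  assumes "e \<noteq> f"
  shows "degree {e, f} v = of_bool (v \<in> e) + of_bool (v \<in> f)"
proof -
  have "{x \<in> {e, f}. v \<in> x} = (if v \<in> e then {e} else {}) \<union> (if v \<in> f then {f} else {})"
    by auto
  then show ?thesis
    using assms by (simp add: degree_def)
qed

lemma degree_union_disjoint:
  assumes "finite E" "finite F" "E \<inter> F = {}"
  shows "degree (E \<union> F) v = degree E v + degree F v"
proof -
  have "{e \<in> E \<union> F. v \<in> e} = {e \<in> E. v \<in> e} \<union> {e \<in> F. v \<in> e}"
    by auto
  moreover have "card ({e \<in> E. v \<in> e} \<union> {e \<in> F. v \<in> e}) = degree E v + degree F v"
    unfolding degree_def using assms by (intro card_Un_disjoint) auto
  ultimately show ?thesis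
    by (simp only: degree_def)
qed

lemma degree_diff:
  assumes "finite E" "F \<subseteq> E"
  shows "degree (E - F) v + degree F v = degree E v"
proof -
  have "(E - F) \<union> F = E" "(E - F) \<inter> F = {}"
    using assms(2) by auto
  moreover have "finite (E - F)" "finite F"
    using assms finite_subset by auto
  ultimately show ?thesis
    using degree_union_disjoint by metis
qed

lemma degree_pos_iff:
  assumes "finite E"
  shows "0 < degree E v \<longleftrightarrow> v \<in> \<Union>E"
proof -
  have "0 < degree E v \<longleftrightarrow> {e \<in> E. v \<in> e} \<noteq> {}"
    using assms by (simp add: degree_def card_gt_0_iff)
  also have "\<dots> \<longleftrightarrow> v \<in> \<Union>E"
    by blast
  finally show ?thesis .
qed

lemma degree_eq_card_neighbours:
  assumes "simple_graph V E"
  shows "degree E v = card (neighbours E v)"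
proof -
  have "inj_on (\<lambda>u. {v, u}) (neighbours E v)"
    by (auto simp: inj_on_def doubleton_eq_iff)
  then have "card ((\<lambda>u. {v, u}) ` neighbours E v) = card (neighbours E v)"
    by (rule card_image)
  moreover have "(\<lambda>u. {v, u}) ` neighbours E v = {e \<in> E. v \<in> e}"
  proof
    show "{e \<in> E. v \<in> e} \<subseteq> (\<lambda>u. {v, u}) ` neighbours E v"
    proof
      fix e assume e: "e \<in> {e \<in> E. v \<in> e}"
      then obtain u where "e = {v, u}"
        using simple_graph_edge_at[OF assms, of e v] by auto
      with e show "e \<in> (\<lambda>u. {v, u}) ` neighbours E v"
        by (intro image_eqI[of _ _ u]) (simp_all add: neighbours_def)
    qed
  qed (auto simp: neighbours_def)
  ultimately show ?thesis
    by (simp add: degree_def)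
qed

lemma neighbours_subset: "simple_graph V E \<Longrightarrow> neighbours E v \<subseteq> V - {v}"
  by (auto simp: neighbours_def dest: simple_graph_edge)

lemma finite_neighbours: "simple_graph V E \<Longrightarrow> finite (neighbours E v)"
  by (rule finite_subset[OF neighbours_subset]) (auto dest: simple_graph_finite)

section \<open>Switches and the red-blue comparison of two graphs\<close>

lemma simple_graph_switch:
  assumes "simple_graph V E" "{a, b} \<in> E" "{c, d} \<in> E" "b \<noteq> c" "a \<noteq> d"
  shows "simple_graph V (switch E a b c d)"
  using assms simple_graph_edge[OF assms(1,2)] simple_graph_edge[OF assms(1,3)]
  by (auto simp: simple_graph_def switch_def doubleton_in_nsets)

lemma degree_switch:
  assumes E: "simple_graph V E"
    and in_E: "{a, b} \<in> E" "{c, d} \<in> E" and notin_E: "{b, c} \<notin> E" "{a, d} \<notin> E"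
    and ne: "a \<noteq> c" "b \<noteq> d" "b \<noteq> c" "a \<noteq> d"
  shows "degree (switch E a b c d) v = degree E v"
proof -
  note fin = simple_graph_finite(2)[OF E]
  have ab: "a \<noteq> b" and cd: "c \<noteq> d"
    using simple_graph_edge[OF E] in_E by auto
  have "degree (switch E a b c d) v
      = degree (E - {{a, b}, {c, d}}) v + degree {{b, c}, {a, d}} v"
    unfolding switch_def using fin notin_E by (intro degree_union_disjoint) auto
  moreover have "degree {{b, c}, {a, d}} v = degree {{a, b}, {c, d}} v"
    using ab cd ne by (auto simp: degree_doubleton doubleton_eq_iff)
  moreover have "degree (E - {{a, b}, {c, d}}) v + degree {{a, b}, {c, d}} v = degree E v"
    using fin in_E by (intro degree_diff) auto
  ultimately show ?thesis
    by simp
qed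

lemma red_blue_red_closed:
  assumes G: "simple_graph V G" and H: "simple_graph V H"
    and minimal: "\<And>G' H'. simple_graph V G' \<Longrightarrow> simple_graph V H' \<Longrightarrow>
      (\<And>v. degree G' v = degree G v) \<Longrightarrow> (\<And>v. degree H' v = degree H v) \<Longrightarrow>
      card (H - G) \<le> card (H' - G')"
    and ab: "{a, b} \<in> G - H" and bc: "{b, c} \<in> H - G" and cd: "{c, d} \<in> G - H" and "a \<noteq> d"
  shows "{a, d} \<in> G - H"
proof -
  \<comment> \<open>If \<open>a = c\<close> or \<open>b = d\<close>, one edge would be both red and
    blue.\<close>
  have ne: "a \<noteq> b" "b \<noteq> c" "c \<noteq> d" "a \<noteq> c" "b \<noteq> d"
    using simple_graph_edge[OF G] simple_graph_edge[OF H] ab bc cd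
    by (auto simp: insert_commute)
  have fin: "finite (H - G)"
    using simple_graph_finite(2)[OF H] by simp
  have "{a, d} \<in> G"
  proof (rule ccontr)
    assume ad: "{a, d} \<notin> G"
    \<comment> \<open>The edges that leave \<open>G\<close> are not in \<open>H\<close>, so no blue
      edge arises, while \<open>{b, c}\<close> enters \<open>G\<close> and stops being blue.\<close>
    have "card (H - G) \<le> card (H - switch G a b c d)"
      using G H ab bc cd ad ne \<open>a \<noteq> d\<close>
      by (intro minimal simple_graph_switch degree_switch[OF G]) auto
    moreover have "H - switch G a b c d \<subset> H - G"
      using ab bc cd by (auto simp: switch_def)
    ultimately show False
      using psubset_card_mono[OF fin] by (meson not_le)
  qed
  moreover have "{a, d} \<notin> H"
  proof
    assume ad: "{a, d} \<in> H"
    \<comment> \<open>Here \<open>{b, c}\<close> leaves \<open>H\<close>, and the edges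
      \<open>{c, d}\<close> and \<open>{a, b}\<close> that enter \<open>H\<close> lie in
      \<open>G\<close>, so they are not blue.\<close>
    have "card (H - G) \<le> card (switch H b c d a - G)"
      using G H ab bc cd ad ne \<open>a \<noteq> d\<close>
      by (intro minimal simple_graph_switch degree_switch[OF H]) (auto simp: insert_commute)
    moreover have "switch H b c d a - G \<subset> H - G"
      using ab bc cd by (auto simp: switch_def insert_commute)
    ultimately show False
      using psubset_card_mono[OF fin] by (meson not_le)
  qed
  ultimately show ?thesis
    by simp
qed

text \<open>By the degree bounds, red degree minus blue degree is 0 or 1 at each vertex. So a vertex
  on a blue edge is also on a red one, and red degree at least 2 forces a blue edge.\<close>

lemma minimal_imp_subset:
  assumes G: "simple_graph V G" and H: "simple_graph V H"
    and deg: "\<And>v. degree H v \<le> degree G v" "\<And>v. degree G v \<le> Suc (degree H v)"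
    and minimal: "\<And>G' H'. simple_graph V G' \<Longrightarrow> simple_graph V H' \<Longrightarrow>
      (\<And>v. degree G' v = degree G v) \<Longrightarrow> (\<And>v. degree H' v = degree H v) \<Longrightarrow>
      card (H - G) \<le> card (H' - G')"
  shows "H \<subseteq> G"
proof (rule ccontr)
  define R where "R = G - H"
  define B where "B = H - G"
  assume "\<not> H \<subseteq> G"
  then obtain e where "e \<in> B"
    unfolding B_def by auto
  have R: "simple_graph V R" and B: "simple_graph V B"
    using simple_graph_subset G H unfolding R_def B_def by blast+
  note finR = simple_graph_finite(2)[OF R] and finB = simple_graph_finite(2)[OF B]
  \<comment> \<open>The common edges \<open>G \<inter> H\<close> contribute equally to both degrees
    and cancel in the comparison of \<open>R\<close> with \<open>B\<close>.\<close>
  have degR: "degree R v + degree (G \<inter> H) v = degree G v" for v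
    using degree_diff[of G "G \<inter> H" v] simple_graph_finite(2)[OF G]
    by (simp add: R_def Diff_Int)
  have degB: "degree B v + degree (G \<inter> H) v = degree H v" for v
    using degree_diff[of H "G \<inter> H" v] simple_graph_finite(2)[OF H]
    by (simp add: B_def Diff_Int)
  have BR: "degree B v \<le> degree R v" and RB: "degree R v \<le> Suc (degree B v)" for v
    using deg[of v] degR[of v] degB[of v] by linarith+
  have "e \<noteq> {}"
    using B \<open>e \<in> B\<close> by (auto simp: simple_graph_def nsets_def)
  have "\<Union>B \<subseteq> V"
    using B by (auto simp: simple_graph_def nsets_def)
  then have "finite (\<Union>B)"
    using simple_graph_finite(1)[OF G] finite_subset by blast
  moreover have "\<Union>B \<noteq> {}"
    using \<open>e \<in> B\<close> \<open>e \<noteq> {}\<close> by auto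
  ultimately obtain c where "c \<in> \<Union>B" and c_max: "\<And>x. x \<in> \<Union>B \<Longrightarrow> degree R x \<le> degree R c"
    using obtains_MAX[of "\<Union>B" "degree R"] Max_ge[of "degree R ` \<Union>B"] by (metis finite_imageI imageI)
  then obtain b where bc: "{b, c} \<in> B"
    using simple_graph_edge_at[OF B] by (metis UnionE insert_commute)
  have "0 < degree R b"
    using BR[of b] degree_pos_iff[OF finB, of b] bc by fastforce
  then obtain a where ab: "{a, b} \<in> R"
    using degree_pos_iff[OF finR] simple_graph_edge_at[OF R] by (metis UnionE insert_commute)
  have closed: "{a, d} \<in> R" if "{c, d} \<in> R" "a \<noteq> d" for d
    using red_blue_red_closed[OF G H minimal, of a b c d] that ab bc
    unfolding R_def B_def by blast
  have b_notin: "b \<notin> neighbours R c"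
    using bc by (auto simp: neighbours_def R_def B_def insert_commute)
  have c_notin: "c \<notin> neighbours R c"
    using neighbours_subset[OF R] by fastforce
  have "Suc (card (neighbours R c)) \<le> card (neighbours R a)"
  proof (cases "a \<in> neighbours R c")
    case True
    \<comment> \<open>Since \<open>a\<close> is not its own neighbour, \<open>c\<close> takes its
      place in the count; \<open>b\<close> is the extra element, as \<open>{b, c}\<close> is blue
      and not red.\<close>
    let ?N = "insert b (insert c (neighbours R c - {a}))"
    have "?N \<subseteq> neighbours R a"
      using ab True closed by (auto simp: neighbours_def insert_commute)
    moreover have "card ?N = Suc (card (neighbours R c))"
      using b_notin c_notin simple_graph_edge(1)[OF B bc] finite_neighbours[OF R, of c]
        card_Suc_Diff1[OF finite_neighbours[OF R, of c] True]
      by simp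
    ultimately show ?thesis
      using card_mono[OF finite_neighbours[OF R]] by metis
  next
    case False
    then have "insert b (neighbours R c) \<subseteq> neighbours R a"
      using ab closed by (auto simp: neighbours_def insert_commute)
    moreover have "card (insert b (neighbours R c)) = Suc (card (neighbours R c))"
      using b_notin finite_neighbours[OF R, of c] by simp
    ultimately show ?thesis
      using card_mono[OF finite_neighbours[OF R]] by metis
  qed
  then have gt: "degree R c < degree R a"
    by (simp add: degree_eq_card_neighbours[OF R])
  moreover have "0 < degree R c"
    using BR[of c] degree_pos_iff[OF finB, of c] \<open>c \<in> \<Union>B\<close> by linarith
  \<comment> \<open>The red degree of \<open>a\<close> exceeds a positive number, so it is at least
    2, and the blue degree is at most one less.\<close>
  ultimately have "0 < degree B a"
    using RB[of a] by linarith
  then show False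
    using c_max[of a] gt degree_pos_iff[OF finB] by fastforce
qed

text \<open>Among all pairs with the prescribed degrees one has the fewest blue edges, the count
  being a natural number. The degree bounds carry over to this pair, so
  \<open>minimal_imp_subset\<close> applies.\<close>

lemma nested_realizations:
  assumes "simple_graph V G" "simple_graph V H"
    and "\<And>v. degree H v \<le> degree G v" "\<And>v. degree G v \<le> Suc (degree H v)"
  obtains G' H' where "simple_graph V G'" "simple_graph V H'" "H' \<subseteq> G'"
    "\<And>v. degree G' v = degree G v" "\<And>v. degree H' v = degree H v"
proof -
  define P where "P = (\<lambda>(G', H'). simple_graph V G' \<and> simple_graph V H' \<and>
    (\<forall>v. degree G' v = degree G v) \<and> (\<forall>v. degree H' v = degree H v))"
  have "P (G, H)"
    using assms by (simp add: P_def)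
  then obtain G' H' where P: "P (G', H')"
    and least: "\<And>G'' H''. P (G'', H'') \<Longrightarrow> card (H' - G') \<le> card (H'' - G'')"
    using ex_has_least_nat[of P "(G, H)" "\<lambda>(G, H). card (H - G)"] by auto
  have "H' \<subseteq> G'"
    using P assms(3,4) by (intro minimal_imp_subset[of V] least) (auto simp: P_def)
  then show ?thesis
    using P that[of G' H'] by (simp add: P_def)
qed

section \<open>Prescribing a neighbourhood by Havel-Hakimi switches\<close>

lemma neighbours_switch_step:
  assumes E: "simple_graph V E"
    and x: "x \<noteq> w" "{w, x} \<notin> E" and y: "{w, y} \<in> E"
    and le: "degree E y \<le> degree E x"
  obtains E' where "simple_graph V E'" "\<And>v. degree E' v = degree E v"
    "neighbours E' w = insert x (neighbours E w - {y})"
proof -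
  have "x \<noteq> y"
    using x y by auto
  have "w \<noteq> y"
    using simple_graph_edge[OF E y] by simp
  \<comment> \<open>Otherwise \<open>y\<close> would have all neighbours of \<open>x\<close> and
    \<open>w\<close> besides, against \<open>le\<close>. A possible edge \<open>{x, y}\<close>
    counts once on each side, so it does not affect the comparison.\<close>
  have "\<not> neighbours E x - {y} \<subseteq> neighbours E y - {w, x}"
  proof
    assume "neighbours E x - {y} \<subseteq> neighbours E y - {w, x}"
    then have sub: "insert w (neighbours E x - {y}) \<subseteq> neighbours E y - {x}"
      using y x by (auto simp: neighbours_def insert_commute)
    have "w \<notin> neighbours E x"
      using x by (simp add: neighbours_def insert_commute)
    then have "Suc (card (neighbours E x - {y})) \<le> card (neighbours E y - {x})"
      using card_mono[OF _ sub] finite_neighbours[OF E] by simp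
    moreover have "y \<in> neighbours E x \<longleftrightarrow> x \<in> neighbours E y"
      by (simp add: neighbours_def insert_commute)
    moreover have "card (neighbours E y) \<le> card (neighbours E x)"
      using le by (simp add: degree_eq_card_neighbours[OF E])
    ultimately show False
      using finite_neighbours[OF E]
      by (cases "y \<in> neighbours E x") (auto simp: card_Diff_singleton_if)
  qed
  then obtain u where u: "{x, u} \<in> E" "u \<noteq> y" "{y, u} \<notin> E \<or> u = w \<or> u = x"
    by (auto simp: neighbours_def)
  have uwx: "u \<noteq> w" "u \<noteq> x"
    using u x simple_graph_edge[OF E u(1)] by (auto simp: insert_commute)
  \<comment> \<open>The edges \<open>{w, y}\<close> and \<open>{u, x}\<close> are traded for
    \<open>{y, u}\<close> and \<open>{w, x}\<close>.\<close>
  let ?E' = "switch E w y u x"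
  show ?thesis
  proof
    show "simple_graph V ?E'"
      using E y u x by (intro simple_graph_switch) (auto simp: insert_commute)
    show "degree ?E' v = degree E v" for v
      using E y u uwx x \<open>x \<noteq> y\<close> by (intro degree_switch[of V]) (auto simp: insert_commute)
    show "neighbours ?E' w = insert x (neighbours E w - {y})"
      using uwx x \<open>w \<noteq> y\<close> \<open>x \<noteq> y\<close> by (auto simp: neighbours_def switch_def doubleton_eq_iff)
  qed
qed

text \<open>As \<open>S\<close> has as many elements as \<open>w\<close> has neighbours, an
  \<open>x\<close> in \<open>S\<close> not adjacent to \<open>w\<close> comes with a neighbour
  \<open>y\<close> of \<open>w\<close> outside \<open>S\<close>. A switch replaces \<open>y\<close>
  by \<open>x\<close>; it keeps all degrees, so the degree condition on \<open>S\<close> survives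
  for the induction.\<close>

lemma havel_hakimi:
  assumes "simple_graph V E" "S \<subseteq> V - {w}" "card S = degree E w"
    and "\<And>x y. x \<in> S \<Longrightarrow> y \<in> V - {w} - S \<Longrightarrow> degree E y \<le> degree E x"
  shows "\<exists>E'. simple_graph V E' \<and> (\<forall>v. degree E' v = degree E v) \<and> neighbours E' w = S"
  using assms
proof (induction "card (S - neighbours E w)" arbitrary: E rule: less_induct)
  case less
  note E = \<open>simple_graph V E\<close>
  have fin: "finite S" "finite (neighbours E w)"
    using less.prems finite_neighbours[OF E] simple_graph_finite(1)[OF E] finite_subset by blast+
  have card: "card S = card (neighbours E w)"
    using less.prems degree_eq_card_neighbours[OF E] by simp
  show ?case
  proof (cases "S \<subseteq> neighbours E w")
    case True
    then show ?thesis
      using E card fin card_subset_eq by metis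
  next
    case False
    then have "\<not> neighbours E w \<subseteq> S"
      using card fin card_subset_eq by (metis order_refl)
    then obtain y where y: "{w, y} \<in> E" "y \<notin> S"
      by (auto simp: neighbours_def)
    obtain x where x: "x \<in> S" "{w, x} \<notin> E"
      using False by (auto simp: neighbours_def)
    have "degree E y \<le> degree E x"
      using less.prems(4)[OF \<open>x \<in> S\<close>, of y] y simple_graph_edge[OF E y(1)] by auto
    then obtain E' where E': "simple_graph V E'" and deg: "\<And>v. degree E' v = degree E v"
      and N: "neighbours E' w = insert x (neighbours E w - {y})"
      using neighbours_switch_step[OF E] x y less.prems(2) by (metis DiffD1 DiffD2 singletonI subsetD)
    have "S - neighbours E' w \<subset> S - neighbours E w"
      using N x y by (auto simp: neighbours_def)
    then have "card (S - neighbours E' w) < card (S - neighbours E w)"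
      using fin by (intro psubset_card_mono) auto
    from less.hyps[OF this E'] less.prems(2-4) show ?thesis
      by (simp add: deg)
  qed
qed

section \<open>Relabelling realizations and deleting a vertex\<close>

lemma realization_on:
  assumes "graphic d" "distinct us" "length us = length d"
  obtains E where "realization us E d"
proof -
  obtain vs :: "nat list" and F where R: "realization vs F d"
    using assms(1) by (auto simp: graphic_def)
  then have dist: "distinct vs" and len: "length vs = length us"
    using assms(3) by (auto simp: realization_def)
  \<comment> \<open>The relabelling sends each vertex of \<open>vs\<close> to the vertex of
    \<open>us\<close> at the same position.\<close>
  define f where "f = (\<lambda>v. us ! (THE i. i < length vs \<and> vs ! i = v))"
  have f: "f (vs ! i) = us ! i" if "i < length vs" for i
  proof -
    have "(THE j. j < length vs \<and> vs ! j = vs ! i) = i"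
      using that dist by (auto simp: nth_eq_iff_index_eq)
    then show ?thesis
      by (simp add: f_def)
  qed
  have map: "map f vs = us"
    using f len by (simp add: list_eq_iff_nth_eq)
  then have "inj_on f (set vs)"
    using assms(2) distinct_map by blast
  then show ?thesis
    using realization_image[OF R] map that by auto
qed

lemma degree_delete_vertex:
  assumes "simple_graph V E" "v \<noteq> w"
  shows "degree {e \<in> E. w \<notin> e} v + of_bool (v \<in> neighbours E w) = degree E v"
proof -
  note fin = simple_graph_finite(2)[OF assms(1)]
  have "e = {w, v}" if "e \<in> E" "w \<in> e" "v \<in> e" for e
    using simple_graph_edge_at[OF assms(1) that(1,2)] that(3) \<open>v \<noteq> w\<close> by auto
  then have "{e \<in> E. w \<in> e \<and> v \<in> e} = {e \<in> E. e = {w, v}}"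
    by blast
  also have "\<dots> = (if v \<in> neighbours E w then {{w, v}} else {})"
    by (auto simp: neighbours_def)
  finally have "{e \<in> {e \<in> E. w \<in> e}. v \<in> e} = (if v \<in> neighbours E w then {{w, v}} else {})"
    by simp
  then have "degree {e \<in> E. w \<in> e} v = of_bool (v \<in> neighbours E w)"
    by (simp add: degree_def)
  moreover have "E - {e \<in> E. w \<in> e} = {e \<in> E. w \<notin> e}"
    by auto
  ultimately show ?thesis
    using degree_diff[of E "{e \<in> E. w \<in> e}" v] fin by auto
qed

lemma simple_graph_delete_vertex:
  "simple_graph (insert w V) E \<Longrightarrow> simple_graph V {e \<in> E. w \<notin> e}"
  by (auto simp: simple_graph_def nsets_def)

section \<open>Degrees and covered vertices of a matching\<close>

lemma degree_matching:
  assumes "finite M" "disjoint M"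
  shows "degree M v = of_bool (v \<in> \<Union>M)"
proof (cases "v \<in> \<Union>M")
  case True
  then obtain e where "e \<in> M" "v \<in> e" by auto
  then have "{e \<in> M. v \<in> e} = {e}"
    using assms(2) by (auto simp: disjoint_def)
  with True show ?thesis
    by (simp add: degree_def)
next
  case False
  then show ?thesis
    using degree_pos_iff[OF assms(1), of v] by simp
qed

lemma card_Union_matching:
  assumes "simple_graph V M" "disjoint M"
  shows "card (\<Union>M) = 2 * card M"
proof -
  have two: "finite e \<and> card e = 2" if "e \<in> M" for e
    using assms(1) that by (auto simp: simple_graph_def nsets_def)
  have "card (\<Union>M) = sum card M"
    using assms(2) two by (intro card_Union_disjoint) (auto simp: disjoint_def pairwise_def disjnt_def)
  then show ?thesis
    using two by simp
qed

section \<open>The two directions of the equivalence\<close>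

lemma graphic_append_if_matching:
  fixes vs :: "nat list"
  assumes "realization vs E d" "matching E M" "2 * card M = \<delta>" "\<delta> \<le> length d"
    and covers: "\<And>i. i < \<delta> \<Longrightarrow> covers M (vs ! i)"
  shows "graphic (d @ [\<delta>])"
proof -
  have E: "simple_graph (set vs) E" and "distinct vs" and d: "map (degree E) vs = d"
    using assms(1) by (auto simp: realization_def)
  have "M \<subseteq> E" and disj: "disjoint M"
    using assms(2) by (auto simp: matching_def)
  note M = simple_graph_subset[OF E \<open>M \<subseteq> E\<close>]
  note finE = simple_graph_finite(2)[OF E] and finM = simple_graph_finite(2)[OF M]
  define S where "S = set (take \<delta> vs)"
  have "length vs = length d"
    using d by auto
  then have cardS: "card S = \<delta>"
    using \<open>distinct vs\<close> assms(4) by (simp add: S_def distinct_card)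
  \<comment> \<open>The matching has just enough edges to cover \<open>S\<close>, so by cardinality
    it covers no other vertex.\<close>
  have "S \<subseteq> \<Union>M"
    using covers by (auto simp: S_def covers_def in_set_conv_nth)
  moreover have "\<Union>M \<subseteq> set vs"
    using M by (auto simp: simple_graph_def nsets_def)
  ultimately have S: "\<Union>M = S"
    using card_Union_matching[OF M disj] cardS assms(3)
    by (metis card_subset_eq finite_subset List.finite_set)
  obtain w where w: "w \<notin> set vs"
    using ex_new_if_finite[OF infinite_UNIV_nat List.finite_set] by blast
  define F where "F = (\<lambda>v. {w, v}) ` S"
  define H where "H = (E - M) \<union> F"
  have SV: "S \<subseteq> set vs"
    by (auto simp: S_def dest: in_set_takeD)
  have H: "simple_graph (set (vs @ [w])) H"
    using E SV w by (auto simp: simple_graph_def H_def F_def nsets_def card_insert_if)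
  have notin_E: "w \<notin> e" if "e \<in> E" for e
    using E w that by (auto simp: simple_graph_def nsets_def)
  \<comment> \<open>A vertex of \<open>S\<close> loses its matching edge and gains the edge to
    \<open>w\<close>; all other old vertices keep their edges.\<close>
  have "degree H v = degree E v" if "v \<in> set vs" for v
  proof -
    have "degree H v = degree (E - M) v + degree F v"
      unfolding H_def using finE notin_E
      by (intro degree_union_disjoint) (auto simp: F_def S_def)
    moreover have "{e \<in> F. v \<in> e} = (if v \<in> S then {{w, v}} else {})"
      using that w by (auto simp: F_def)
    then have "degree F v = of_bool (v \<in> S)"
      by (simp add: degree_def)
    ultimately show ?thesis
      using degree_diff[OF finE \<open>M \<subseteq> E\<close>, of v] degree_matching[OF finM disj] S by simp
  qed
  moreover have "degree H w = \<delta>"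
  proof -
    have "neighbours H w = S"
      using notin_E SV w by (auto simp: neighbours_def H_def F_def doubleton_eq_iff)
    then show ?thesis
      using degree_eq_card_neighbours[OF H] cardS by simp
  qed
  ultimately have "realization (vs @ [w]) H (d @ [\<delta>])"
    using H \<open>distinct vs\<close> w d by (auto simp: realization_def)
  then show ?thesis
    by (rule realization_imp_graphic)
qed

lemma matching_if_graphic_append:
  assumes "graphic d" "sorted_wrt (\<ge>) d" "\<delta> \<le> length d" "graphic (d @ [\<delta>])"
  obtains us :: "nat list" and E M where
    "realization us E d" "matching E M" "2 * card M = \<delta>" "\<And>i. i < \<delta> \<Longrightarrow> covers M (us ! i)"
proof -
  obtain ws :: "nat list" and F where R: "realization ws F (d @ [\<delta>])"
    using assms(4) by (auto simp: graphic_def)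
  then have "map (degree F) ws = d @ [\<delta>]"
    by (simp add: realization_def)
  then obtain us w where ws: "ws = us @ [w]" and d: "map (degree F) us = d" and w: "degree F w = \<delta>"
    by (auto simp: map_eq_append_conv)
  define V where "V = set us"
  have F: "simple_graph (insert w V) F" and "distinct us" "w \<notin> V"
    using R by (auto simp: realization_def ws V_def)
  have len: "length us = length d"
    using d by auto
  define S where "S = set (take \<delta> us)"
  have cardS: "card S = \<delta>"
    using \<open>distinct us\<close> assms(3) len by (simp add: S_def distinct_card)
  have SV: "S \<subseteq> V"
    by (auto simp: S_def V_def dest: in_set_takeD)
  \<comment> \<open>The degrees of \<open>F\<close> along \<open>us\<close> are the decreasing
    sequence \<open>d\<close>, so its first \<delta> vertices satisfy the Havel-Hakimi
    condition.\<close>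
  have "degree F y \<le> degree F x" if "x \<in> S" "y \<in> V - S" for x y
  proof -
    have "V - S \<subseteq> set (drop \<delta> us)"
      unfolding V_def S_def by (metis Diff_subset_conv append_take_drop_id order_refl set_append)
    with that have y: "y \<in> set (drop \<delta> us)" by blast
    have "sorted_wrt (\<lambda>x y. degree F x \<ge> degree F y) (take \<delta> us @ drop \<delta> us)"
      using assms(2) unfolding d[symmetric] by (simp add: sorted_wrt_map)
    then show ?thesis
      using that y unfolding sorted_wrt_append S_def by blast
  qed
  then have "\<exists>F'. simple_graph (insert w V) F' \<and> (\<forall>v. degree F' v = degree F v) \<and> neighbours F' w = S"
    using F SV \<open>w \<notin> V\<close> cardS w by (intro havel_hakimi) auto
  then obtain F' where F': "simple_graph (insert w V) F'"
    and degF': "\<And>v. degree F' v = degree F v" and S: "neighbours F' w = S"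
    by blast
  define H where "H = {e \<in> F'. w \<notin> e}"
  have H: "simple_graph V H"
    unfolding H_def using F' by (rule simple_graph_delete_vertex)
  \<comment> \<open>Relabelling puts a realization of \<open>d\<close> on the vertices of
    \<open>H\<close>, so that the two graphs can be compared.\<close>
  obtain G where G: "realization us G d"
    using realization_on[OF assms(1) \<open>distinct us\<close> len] .
  then have G': "simple_graph V G" and degG: "map (degree G) us = map (degree F) us"
    by (auto simp: realization_def d V_def)
  \<comment> \<open>On \<open>V\<close>, the graphs \<open>G\<close> and \<open>F'\<close> have
    equal degrees, and deleting \<open>w\<close> costs one exactly on \<open>S\<close>. Outside
    \<open>V\<close> all terms are zero, which gives the bounds for every \<open>v\<close> as
    \<open>nested_realizations\<close> asks.\<close>
  have deg: "degree G v = degree H v + of_bool (v \<in> S)" for v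
  proof (cases "v \<in> V")
    case True
    then have "v \<noteq> w"
      using \<open>w \<notin> V\<close> by auto
    then show ?thesis
      using degree_delete_vertex[OF F' \<open>v \<noteq> w\<close>] degF'[of v] S degG True by (simp add: H_def V_def)
  next
    case False
    then have "degree E v = 0" if "simple_graph V E" for E
      using that degree_pos_iff[OF simple_graph_finite(2)[OF that], of v]
      by (auto simp: simple_graph_def nsets_def)
    then show ?thesis
      using G' H False SV by auto
  qed
  obtain G1 H1 where G1: "simple_graph V G1" and H1: "H1 \<subseteq> G1"
    and deg1: "\<And>v. degree G1 v = degree G v" "\<And>v. degree H1 v = degree H v"
    by (rule nested_realizations[OF G' H]) (auto simp: deg)
  define M where "M = G1 - H1"
  note finG1 = simple_graph_finite(2)[OF G1]
  have M: "simple_graph V M"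
    using simple_graph_subset[OF G1] by (auto simp: M_def)
  note finM = simple_graph_finite(2)[OF M]
  have degM: "degree M v = of_bool (v \<in> S)" for v
    using degree_diff[OF finG1 H1, of v] deg1[of v] deg[of v] by (simp add: M_def)
  have disj: "disjoint M"
  proof (rule disjointI)
    fix e e' assume e: "e \<in> M" "e' \<in> M" "e \<noteq> e'"
    show "e \<inter> e' = {}"
    proof (rule ccontr)
      assume "e \<inter> e' \<noteq> {}"
      then obtain v where "v \<in> e" "v \<in> e'" by auto
      \<comment> \<open>Two distinct edges at \<open>v\<close> would give it degree at least 2 in
        \<open>M\<close>, but \<open>degM\<close> allows at most 1.\<close>
      then have "card {e, e'} \<le> degree M v"
        unfolding degree_def using e finM by (intro card_mono) auto
      then show False
        using degM[of v] e by (auto simp: of_bool_def split: if_splits)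
    qed
  qed
  have UM: "\<Union>M = S"
    unfolding set_eq_iff degree_pos_iff[OF finM, symmetric] degM by simp
  show ?thesis
  proof
    show "realization us G1 d"
      using G G1 deg1 by (simp add: realization_def V_def cong: map_cong)
    show "matching G1 M"
      using disj by (auto simp: matching_def M_def)
    show "2 * card M = \<delta>"
      using card_Union_matching[OF M disj] UM cardS by simp
    show "covers M (us ! i)" if "i < \<delta>" for i
    proof -
      have "us ! i \<in> S"
        using that assms(3) len by (auto simp: S_def in_set_conv_nth)
      then show ?thesis
        unfolding covers_def using UM by auto
    qed
  qed
qed

theorem theorem2p9:
  fixes d :: "nat list" and \<delta> :: nat
  assumes "graphic d"
    and "sorted_wrt (\<ge>) d"
    and "\<delta> \<le> length d" and "\<delta> > 0" and "even \<delta>"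
  shows "graphic (d @ [\<delta>]) \<longleftrightarrow>
    (\<exists>(vs :: nat list) E. realization vs E d \<and>
       (\<exists>M. matching E M \<and> card M = \<delta> div 2 \<and> (\<forall>i<\<delta>. covers M (vs ! i))))"
proof
  assume "graphic (d @ [\<delta>])"
  then obtain us :: "nat list" and E M where "realization us E d" "matching E M"
    "2 * card M = \<delta>" "\<And>i. i < \<delta> \<Longrightarrow> covers M (us ! i)"
    using matching_if_graphic_append assms(1-3) by blast
  then show "\<exists>(vs :: nat list) E. realization vs E d \<and>
       (\<exists>M. matching E M \<and> card M = \<delta> div 2 \<and> (\<forall>i<\<delta>. covers M (vs ! i)))"
    by fastforce
next
  assume "\<exists>(vs :: nat list) E. realization vs E d \<and>
       (\<exists>M. matching E M \<and> card M = \<delta> div 2 \<and> (\<forall>i<\<delta>. covers M (vs ! i)))"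
  \<comment> \<open>Evenness of \<delta> turns \<open>card M = \<delta> div 2\<close> into
    \<open>2 * card M = \<delta>\<close>.\<close>
  then show "graphic (d @ [\<delta>])"
    using graphic_append_if_matching assms(3,5) by (metis dvd_mult_div_cancel)
qed

end
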